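(* Let $N\ge 1$ and let $a,b>0$. Let $\mathbb{P}_{\mathrm H}$ be the law on $\mathcal S$ of the steady state height function of the open TASEP on $\{1,\dots,N\}$ with parameters $\alpha=\frac{1}{1+a}$, $\beta=\frac{1}{1+b}$, and let $\mathbb{P}_{\mathrm{TLE}}$ be the two-line ensemble on $\mathcal S\times\mathcal S$ with parameters $a,b$. Then the marginal law of the first coordinate $\boldsymbol S_1:(\boldsymbol s_1,\boldsymbol s_2)\mapsto \boldsymbol s_1$ under $\mathbb{P}_{\mathrm{TLE}}$ is the (unique) law of the steady state height function; that is, for every $\boldsymbol s\in\mathcal S$, $$\mathbb{P}_{\mathrm H}(\boldsymbol s)=\sum_{\boldsymbol s'\in\mathcal S}\mathbb{P}_{\mathrm{TLE}}(\boldsymbol s,\boldsymbol s').$$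
   Context: Open TASEP: for $\alpha,\beta\in(0,1)$, the totally asymmetric simple exclusion process with open boundaries on $\{1,\dots,N\}$ is the continuous-time Markov chain on $\Omega=\{0,1\}^N$ (with $\tau_j=1$ iff site $j$ is occupied) with the following transitions: a particle at site $j$ ($1\le j\le N-1$) jumps to site $j+1$ at rate $1$ if site $j+1$ is empty; if site $1$ is empty, a particle is inserted there at rate $\alpha$; if site $N$ is occupied, its particle is removed at rate $\beta$. Its unique stationary distribution is denoted $\mathbb{P}_{\mathrm{TASEP}}$. The parameters are re-expressed as $a=\frac{1-\alpha}{\alpha}$, $b=\frac{1-\beta}{\beta}$. Height function: $H_N(k)=\tau_1+\dots+\tau_k$ for $k=0,1,\dots,N$ (so $H_N(0)=0$), where $(\tau_1,\dots,\tau_N)$ has law $\mathbb{P}_{\mathrm{TASEP}}$. It takes values in $$\mathcal S=\{\boldsymbol s=(s_j)_{0\le j\le N}:\ s_0=0,\ s_j-s_{j-1}\in\{0,1\},\ 1\le j\le N\},$$ and $\mathbb{P}_{\mathrm H}$ denotes its law on $\mathcal S$. For $\boldsymbol s\in\mathcal S$ we also write $s(j)=s_j$. Two-line ensemble: $\mathbb{P}_{\mathrm{TLE}}$ is the probability measure on $\mathcal S\times\mathcal S$ given by $$\mathbb{P}_{\mathrm{TLE}}(\boldsymbol s_1,\boldsymbol s_2)=\frac{1}{\mathfrak C_{a,b}}\;\frac{b^{\,s_1(N)-s_2(N)}}{(ab)^{\min_{0\le j\le N}\{s_1(j)-s_2(j)\}}}\;\mathbb{P}_{\mathrm{rw}}(\boldsymbol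 s_1,\boldsymbol s_2),$$ where $\mathbb{P}_{\mathrm{rw}}(\boldsymbol s_1,\boldsymbol s_2)=4^{-N}$ is the uniform law on $\mathcal S\times\mathcal S$ (two independent random walks with i.i.d. Bernoulli$(1/2)$ increments) and $\mathfrak C_{a,b}$ is the normalization constant. *)

theory Defs
  imports "HOL-Probability.Probability"
begin

section \<open>Continuous-time Markov chains on a finite state space\<close>

text \<open>
  The chain on the finite set \<open>S\<close> jumps from \<open>x\<close> to \<open>y\<close> (with \<open>y \<noteq> x\<close>) at rate \<open>q x y\<close>. Its transition
  probabilities are the entries of the matrix exponential \<open>exp (t Q)\<close> of its generator \<open>Q\<close>, and a
  stationary distribution is a law on \<open>S\<close> that is preserved by the transition probabilities at all
  times.
\<close>

definition ctmc_generator :: "'a set \<Rightarrow> ('a \<Rightarrow> 'a \<Rightarrow> real) \<Rightarrow> 'a \<Rightarrow> 'a \<Rightarrow> real" where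
  "ctmc_generator S q x y = (if x = y then - (\<Sum>z\<in>S - {x}. q x z) else q x y)"

primrec ctmc_generator_power :: "'a set \<Rightarrow> ('a \<Rightarrow> 'a \<Rightarrow> real) \<Rightarrow> nat \<Rightarrow> 'a \<Rightarrow> 'a \<Rightarrow> real" where
  "ctmc_generator_power S q 0 x y = (if x = y then 1 else 0)"
| "ctmc_generator_power S q (Suc k) x y =
     (\<Sum>z\<in>S. ctmc_generator_power S q k x z * ctmc_generator S q z y)"

definition ctmc_transition :: "'a set \<Rightarrow> ('a \<Rightarrow> 'a \<Rightarrow> real) \<Rightarrow> real \<Rightarrow> 'a \<Rightarrow> 'a \<Rightarrow> real" where
  "ctmc_transition S q t x y = (\<Sum>k. t ^ k / fact k * ctmc_generator_power S q k x y)"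

definition stationary_distribution :: "'a set \<Rightarrow> ('a \<Rightarrow> 'a \<Rightarrow> real) \<Rightarrow> 'a pmf \<Rightarrow> bool" where
  "stationary_distribution S q \<mu> \<longleftrightarrow>
     set_pmf \<mu> \<subseteq> S \<and>
     (\<forall>t\<ge>0. \<forall>y\<in>S. (\<Sum>x\<in>S. pmf \<mu> x * ctmc_transition S q t x y) = pmf \<mu> y)"


section \<open>Open TASEP\<close>

text \<open>Configurations are extensional functions, i.e. \<open>undefined\<close> off the sites \<open>{1..N}\<close>.\<close>

definition configs :: "nat \<Rightarrow> (nat \<Rightarrow> int) set" where
  "configs N = {1..N} \<rightarrow>\<^sub>E {0, 1}"

text \<open>
  The rate from \<open>\<sigma>\<close> to \<open>\<tau>\<close> sums the rates of all transitions leading from \<open>\<sigma>\<close> to \<open>\<tau>\<close>: bulk jumps,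
  insertion at site 1 and removal at site \<open>N\<close>.
\<close>

definition tasep_rate ::
    "nat \<Rightarrow> real \<Rightarrow> real \<Rightarrow> (nat \<Rightarrow> int) \<Rightarrow> (nat \<Rightarrow> int) \<Rightarrow> real" where
  "tasep_rate N \<alpha> \<beta> \<sigma> \<tau> =
     (\<Sum>j\<in>{1..<N}. if \<sigma> j = 1 \<and> \<sigma> (j + 1) = 0 \<and> \<tau> = \<sigma>(j := 0, j + 1 := 1) then 1 else 0)
   + (if \<sigma> 1 = 0 \<and> \<tau> = \<sigma>(1 := 1) then \<alpha> else 0)
   + (if \<sigma> N = 1 \<and> \<tau> = \<sigma>(N := 0) then \<beta> else 0)"

definition tasep_stationary :: "nat \<Rightarrow> real \<Rightarrow> real \<Rightarrow> (nat \<Rightarrow> int) pmf \<Rightarrow> bool" where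
  "tasep_stationary N \<alpha> \<beta> \<mu> \<longleftrightarrow> stationary_distribution (configs N) (tasep_rate N \<alpha> \<beta>) \<mu>"

definition P_TASEP :: "nat \<Rightarrow> real \<Rightarrow> real \<Rightarrow> (nat \<Rightarrow> int) pmf" where
  "P_TASEP N \<alpha> \<beta> = (THE \<mu>. tasep_stationary N \<alpha> \<beta> \<mu>)"


section \<open>Height function\<close>

text \<open>Paths are extensional functions on \<open>{0..N}\<close>.\<close>

definition paths :: "nat \<Rightarrow> (nat \<Rightarrow> int) set" where
  "paths N = {s \<in> extensional {0..N}. s 0 = 0 \<and> (\<forall>j\<in>{1..N}. s j - s (j - 1) \<in> {0, 1})}"

definition height :: "nat \<Rightarrow> (nat \<Rightarrow> int) \<Rightarrow> nat \<Rightarrow> int" where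
  "height N \<tau> = (\<lambda>k\<in>{0..N}. \<Sum>j=1..k. \<tau> j)"

definition P_H :: "nat \<Rightarrow> real \<Rightarrow> real \<Rightarrow> (nat \<Rightarrow> int) pmf" where
  "P_H N \<alpha> \<beta> = map_pmf (height N) (P_TASEP N \<alpha> \<beta>)"


section \<open>Two-line ensemble\<close>

definition P_rw :: "nat \<Rightarrow> ((nat \<Rightarrow> int) \<times> (nat \<Rightarrow> int)) pmf" where
  "P_rw N = pmf_of_set (paths N \<times> paths N)"

definition tle_weight ::
    "nat \<Rightarrow> real \<Rightarrow> real \<Rightarrow> (nat \<Rightarrow> int) \<times> (nat \<Rightarrow> int) \<Rightarrow> real" where
  "tle_weight N a b = (\<lambda>(s1, s2).
     b powi (s1 N - s2 N) / (a * b) powi (Min ((\<lambda>j. s1 j - s2 j) ` {0..N})) * pmf (P_rw N) (s1, s2))"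

definition tle_const :: "nat \<Rightarrow> real \<Rightarrow> real \<Rightarrow> real" where
  "tle_const N a b = (\<Sum>p\<in>paths N \<times> paths N. tle_weight N a b p)"

definition P_TLE :: "nat \<Rightarrow> real \<Rightarrow> real \<Rightarrow> ((nat \<Rightarrow> int) \<times> (nat \<Rightarrow> int)) pmf" where
  "P_TLE N a b = embed_pmf (\<lambda>p. tle_weight N a b p / tle_const N a b)"

text \<open>
  The remaining facts show that for \<open>a, b > 0\<close> the function embedded in \<open>P_TLE\<close> is indeed a
  probability mass function, and that \<open>P_rw\<close> has mass \<open>4\<^sup>-\<^sup>N\<close> at every pair of paths.
\<close>

lemma height_in_paths: "\<tau> \<in> configs N \<Longrightarrow> height N \<tau> \<in> paths N"
proof -
  assume t: "\<tau> \<in> configs N"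
  have "height N \<tau> j - height N \<tau> (j - 1) \<in> {0, 1}" if j: "j \<in> {1..N}" for j
  proof -
    obtain i where i: "j = Suc i" using j by (cases j) auto
    have "height N \<tau> j - height N \<tau> (j - 1) = \<tau> j"
      using j by (simp add: height_def i)
    moreover have "\<tau> j \<in> {0, 1}" using t j by (auto simp: configs_def PiE_iff)
    ultimately show ?thesis by simp
  qed
  then show ?thesis by (auto simp: paths_def height_def)
qed

lemma bij_betw_height: "bij_betw (height N) (configs N) (paths N)"
proof (rule bij_betwI[where g = "\<lambda>s. \<lambda>j\<in>{1..N}. s j - s (j - 1)"])
  show "height N \<in> configs N \<rightarrow> paths N" by (auto intro: height_in_paths)
  show "(\<lambda>s. \<lambda>j\<in>{1..N}. s j - s (j - 1)) \<in> paths N \<rightarrow> configs N"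
    by (auto simp: configs_def paths_def)
next
  fix t assume t: "t \<in> configs N"
  show "(\<lambda>j\<in>{1..N}. height N t j - height N t (j - 1)) = t"
  proof
    fix j
    show "(\<lambda>j\<in>{1..N}. height N t j - height N t (j - 1)) j = t j"
      using t by (cases j) (auto simp: height_def configs_def PiE_iff extensional_def)
  qed
next
  fix s assume s: "s \<in> paths N"
  show "height N (\<lambda>j\<in>{1..N}. s j - s (j - 1)) = s"
  proof
    fix k
    have "(\<Sum>j=1..k. (\<lambda>j\<in>{1..N}. s j - s (j - 1)) j) = s k" if "k \<le> N"
      using that s by (induction k) (auto simp: paths_def)
    then show "height N (\<lambda>j\<in>{1..N}. s j - s (j - 1)) k = s k"
      using s by (auto simp: height_def paths_def extensional_def)
  qed
qed

lemma finite_paths: "finite (paths N)"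
  using bij_betw_finite[OF bij_betw_height[of N]] by (simp add: configs_def finite_PiE)

lemma card_paths: "card (paths N) = 2 ^ N"
  using bij_betw_same_card[OF bij_betw_height[of N]] by (simp add: configs_def card_PiE numeral_2_eq_2)

lemma paths_nonempty: "paths N \<noteq> {}"
  using card_paths[of N] by auto

lemma pmf_P_rw: "pmf (P_rw N) p = (if p \<in> paths N \<times> paths N then 1 / 4 ^ N else 0)"
proof -
  have "(2::real) ^ N * 2 ^ N = 4 ^ N" by (simp flip: power_mult_distrib)
  then show ?thesis
    unfolding P_rw_def
    by (simp add: pmf_of_set finite_paths paths_nonempty card_cartesian_product card_paths)
qed

lemma tle_weight_nonneg: "a > 0 \<Longrightarrow> b > 0 \<Longrightarrow> tle_weight N a b p \<ge> 0"
  by (auto simp: tle_weight_def split: prod.split)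

lemma tle_const_pos:
  assumes "a > 0" "b > 0"
  shows "tle_const N a b > 0"
  unfolding tle_const_def
proof (rule sum_pos)
  show "0 < tle_weight N a b p" if "p \<in> paths N \<times> paths N" for p
    using that assms by (auto simp: tle_weight_def pmf_P_rw)
qed (use finite_paths paths_nonempty in auto)

lemma pmf_P_TLE:
  assumes "a > 0" "b > 0"
  shows "pmf (P_TLE N a b) p = tle_weight N a b p / tle_const N a b"
  unfolding P_TLE_def
proof (rule pmf_embed_pmf)
  let ?f = "\<lambda>p. tle_weight N a b p / tle_const N a b"
  show nonneg: "0 \<le> ?f p" for p
    using tle_weight_nonneg[OF assms] tle_const_pos[OF assms, of N] by simp
  have zero: "?f p = 0" if "p \<notin> paths N \<times> paths N" for p
    using that by (cases p) (auto simp: tle_weight_def pmf_P_rw)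
  have "(\<integral>\<^sup>+p. ennreal (?f p) \<partial>count_space UNIV) = (\<Sum>p\<in>paths N \<times> paths N. ennreal (?f p))"
  proof (rule nn_integral_count_space')
    show "ennreal (?f p) = 0" if "p \<notin> paths N \<times> paths N" for p
      unfolding zero[OF that] by (rule ennreal_0)
  qed (auto simp: finite_paths)
  also have "\<dots> = ennreal (\<Sum>p\<in>paths N \<times> paths N. ?f p)"
    using nonneg by (intro sum_ennreal) auto
  also have "(\<Sum>p\<in>paths N \<times> paths N. ?f p) = 1"
    using tle_const_pos[OF assms, of N]
    by (simp add: tle_const_def flip: sum_divide_distrib)
  finally show "(\<integral>\<^sup>+p. ennreal (?f p) \<partial>count_space UNIV) = 1" by simp
qed

end

theory Submission
  imports Defs
begin

text \<open>
  The second line \<open>s2\<close> of the ensemble can be summed out site by site. Follow the height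
  \<open>h = (s1 - s2) - min (s1 - s2)\<close> of the difference walk above its running minimum. It starts at \<open>0\<close>; at an
  occupied site of the first line it stays or goes up, at an empty site it stays or goes down, and at height
  \<open>0\<close> the down step is replaced by a stay of weight \<open>a\<close>. Since
  \<open>b\<^sup>d / (a b)\<^sup>m = a\<^sup>-\<^sup>m b\<^sup>d\<^sup>-\<^sup>m\<close>, the total weight of the second line, given occupation numbers \<open>\<tau>\<close>, is
  a matrix product \<open>\<langle>W| X\<^sub>1 \<cdots> X\<^sub>N |V\<rangle>\<close>, where \<open>X\<^sub>j\<close> is \<open>D\<close> or \<open>E\<close> according to \<open>\<tau> j\<close>, the row vector
  \<open>W\<close> is the unit vector at \<open>0\<close>, and \<open>V h = b\<^sup>h\<close> (lemmas \<open>sum_paths_reflected\<close> and \<open>sum_tle_weight\<close>).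

  These matrices satisfy the relations of Derrida, Evans, Hakim and Pasquier,
  \<open>D E = D + E\<close>, \<open>\<langle>W| E = (1 + a) \<langle>W|\<close> and \<open>D |V\<rangle> = (1 + b) |V\<rangle>\<close>, and \<open>1 + a = 1 / \<alpha>\<close>,
  \<open>1 + b = 1 / \<beta>\<close>. By them the net probability flow into \<open>\<tau>\<close> through each bond is a difference of two weights of
  systems of \<open>N - 1\<close> sites; the differences telescope, and the reservoirs compensate the two ends
  (\<open>mp_weight_invariant\<close>). So the first marginal of the ensemble, read as a law of configurations, is annihilated
  by the generator.

  That this is stationarity, and that it determines the law, are general facts on finite chains: a law is
  stationary exactly if it is annihilated by the generator (\<open>stationary_distribution_iff_generator\<close>), and an irreducible
  chain has at most one such law (\<open>stationary_distribution_unique\<close>).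
\<close>

section \<open>Finite continuous-time chains\<close>

text \<open>
  This geometric bound dominates the series of \<open>ctmc_transition\<close> by an exponential series, so that it may be
  handled as an everywhere convergent power series in \<open>t\<close>.
\<close>

lemma ctmc_generator_power_bound:
  assumes "finite S" "y \<in> S"
  shows "\<bar>ctmc_generator_power S q k x y\<bar> \<le> (\<Sum>u\<in>S. \<Sum>v\<in>S. \<bar>ctmc_generator S q u v\<bar>) ^ k"
  using assms(2)
proof (induction k arbitrary: y)
  case 0
  then show ?case by simp
next
  case (Suc k)
  let ?C = "\<Sum>u\<in>S. \<Sum>v\<in>S. \<bar>ctmc_generator S q u v\<bar>"
  have C: "0 \<le> ?C" by (intro sum_nonneg) auto
  have "\<bar>ctmc_generator_power S q (Suc k) x y\<bar>
      \<le> (\<Sum>z\<in>S. \<bar>ctmc_generator_power S q k x z\<bar> * \<bar>ctmc_generator S q z y\<bar>)"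
    by (simp flip: abs_mult)
  also have "\<dots> \<le> (\<Sum>z\<in>S. ?C ^ k * (\<Sum>v\<in>S. \<bar>ctmc_generator S q z v\<bar>))"
  proof (intro sum_mono mult_mono)
    fix z assume "z \<in> S"
    then show "\<bar>ctmc_generator_power S q k x z\<bar> \<le> ?C ^ k" by (rule Suc.IH)
    show "\<bar>ctmc_generator S q z y\<bar> \<le> (\<Sum>v\<in>S. \<bar>ctmc_generator S q z v\<bar>)"
      using assms(1) Suc.prems by (intro member_le_sum) auto
  qed (use C in auto)
  also have "\<dots> = ?C ^ Suc k" by (metis sum_distrib_left power_Suc2)
  finally show ?case .
qed

lemma summable_ctmc_transition:
  assumes "finite S" "y \<in> S"
  shows "summable (\<lambda>k. t ^ k / fact k * ctmc_generator_power S q k x y)"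
proof (rule summable_comparison_test'[where N = 0])
  let ?C = "\<Sum>u\<in>S. \<Sum>v\<in>S. \<bar>ctmc_generator S q u v\<bar>"
  show "summable (\<lambda>k. inverse (fact k) * (\<bar>t\<bar> * ?C) ^ k)" by (rule summable_exp)
  fix k
  have "norm (t ^ k / fact k * ctmc_generator_power S q k x y)
      = \<bar>t\<bar> ^ k / fact k * \<bar>ctmc_generator_power S q k x y\<bar>"
    by (simp add: abs_mult power_abs)
  also have "\<dots> \<le> \<bar>t\<bar> ^ k / fact k * ?C ^ k"
    by (intro mult_left_mono ctmc_generator_power_bound assms) auto
  finally show "norm (t ^ k / fact k * ctmc_generator_power S q k x y)
      \<le> inverse (fact k) * (\<bar>t\<bar> * ?C) ^ k"
    by (simp add: power_mult_distrib field_simps)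
qed

text \<open>
  Both sides are statements about the power series
  \<open>(\<mu> exp (t Q)) y = \<Sum>k. (\<mu> Q\<^sup>k) y t\<^sup>k / k!\<close>: if \<open>\<mu> Q = 0\<close> only its constant term survives, and if it is
  constant for \<open>t \<ge> 0\<close> then its derivative \<open>(\<mu> Q) y\<close> at \<open>0\<close> vanishes.
\<close>

lemma stationary_distribution_iff_generator:
  assumes fin: "finite S"
  shows "stationary_distribution S q \<mu> \<longleftrightarrow>
    set_pmf \<mu> \<subseteq> S \<and> (\<forall>y\<in>S. (\<Sum>x\<in>S. pmf \<mu> x * ctmc_generator S q x y) = 0)"
proof -
  define p where "p k y = (\<Sum>x\<in>S. pmf \<mu> x * ctmc_generator_power S q k x y)" for k y
  have p0: "p 0 y = pmf \<mu> y" if "y \<in> S" for y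
    using fin that by (simp add: p_def if_distrib cong: if_cong)
  have pSuc: "p (Suc k) y = (\<Sum>z\<in>S. p k z * ctmc_generator S q z y)" for k y
    unfolding p_def by (simp add: sum_distrib_left sum_distrib_right mult.assoc) (rule sum.swap)
  have p1: "p 1 y = (\<Sum>z\<in>S. pmf \<mu> z * ctmc_generator S q z y)" for y
    using pSuc[of 0 y] p0 by simp
  have sums: "(\<lambda>k. p k y / fact k * t ^ k) sums (\<Sum>x\<in>S. pmf \<mu> x * ctmc_transition S q t x y)"
    if "y \<in> S" for y t
  proof -
    have "(\<lambda>k. \<Sum>x\<in>S. pmf \<mu> x * (t ^ k / fact k * ctmc_generator_power S q k x y)) sums
        (\<Sum>x\<in>S. pmf \<mu> x * ctmc_transition S q t x y)"
      unfolding ctmc_transition_def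
      by (intro sums_sum sums_mult summable_sums summable_ctmc_transition fin that)
    moreover have "(\<Sum>x\<in>S. pmf \<mu> x * (t ^ k / fact k * ctmc_generator_power S q k x y))
        = p k y / fact k * t ^ k" for k
      unfolding p_def sum_divide_distrib sum_distrib_right by (simp add: mult_ac)
    ultimately show ?thesis by simp
  qed
  have "(\<forall>t\<ge>0. \<forall>y\<in>S. (\<Sum>x\<in>S. pmf \<mu> x * ctmc_transition S q t x y) = pmf \<mu> y)
      \<longleftrightarrow> (\<forall>y\<in>S. p 1 y = 0)" (is "?stat \<longleftrightarrow> ?bal")
  proof
    assume stat: ?stat
    show ?bal
    proof
      fix y assume y: "y \<in> S"
      define c where "c k = p k y / fact k" for k
      define F where "F t = (\<Sum>k. c k * t ^ k)" for t :: real
      have F: "F t = (\<Sum>x\<in>S. pmf \<mu> x * ctmc_transition S q t x y)" for t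
        unfolding F_def c_def using sums[OF y] by (rule sums_unique[symmetric])
      have "(F has_field_derivative (\<Sum>k. diffs c k * 0 ^ k)) (at 0)"
        unfolding F_def
      proof (rule termdiffs_strong_converges_everywhere)
        show "summable (\<lambda>k. c k * t ^ k)" for t
          unfolding c_def using sums[OF y] by (rule sums_summable)
      qed
      then have "(F has_field_derivative p 1 y) (at 0)"
        unfolding powser_zero by (simp add: diffs_def c_def)
      then have "(F has_field_derivative p 1 y) (at 0 within {0..})"
        by (rule has_field_derivative_at_within)
      moreover have "(F has_field_derivative 0) (at 0 within {0..})"
      proof (rule has_field_derivative_transform_within[where d = 1])
        show "((\<lambda>t. pmf \<mu> y) has_field_derivative 0) (at 0 within {0..})" by simp
      qed (use stat y F in auto)
      ultimately show "p 1 y = 0"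
        by (rule has_field_derivative_unique) (simp add: at_within_Ici_at_right)
    qed
  next
    assume bal: ?bal
    have pk: "p (Suc k) y = 0" if "y \<in> S" for k y
      using that
    proof (induction k arbitrary: y)
      case 0
      then show ?case using bal by simp
    next
      case (Suc k)
      show ?case unfolding pSuc[of "Suc k"] using Suc.IH by simp
    qed
    show ?stat
    proof (intro allI impI ballI)
      fix t :: real and y assume y: "y \<in> S"
      have "(\<lambda>k. p k y / fact k * t ^ k) sums (\<Sum>k\<in>{0}. p k y / fact k * t ^ k)"
        by (rule sums_finite) (use pk[OF y] in \<open>auto simp: gr0_conv_Suc\<close>)
      with sums[OF y, of t] have "(\<Sum>x\<in>S. pmf \<mu> x * ctmc_transition S q t x y)
          = (\<Sum>k\<in>{0}. p k y / fact k * t ^ k)" by (rule sums_unique2)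
      then show "(\<Sum>x\<in>S. pmf \<mu> x * ctmc_transition S q t x y) = pmf \<mu> y"
        using p0[OF y] by simp
    qed
  qed
  then show ?thesis unfolding stationary_distribution_def p1 by simp
qed

definition ctmc_step :: "'a set \<Rightarrow> ('a \<Rightarrow> 'a \<Rightarrow> real) \<Rightarrow> 'a \<Rightarrow> 'a \<Rightarrow> bool" where
  "ctmc_step S q x y \<longleftrightarrow> x \<in> S \<and> y \<in> S \<and> x \<noteq> y \<and> q x y > 0"

definition ctmc_irreducible :: "'a set \<Rightarrow> ('a \<Rightarrow> 'a \<Rightarrow> real) \<Rightarrow> bool" where
  "ctmc_irreducible S q \<longleftrightarrow> (\<forall>x\<in>S. \<forall>y\<in>S. (ctmc_step S q)\<^sup>*\<^sup>* x y)"

text \<open>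
  At a zero \<open>y\<close> of \<open>f\<close>, the equation \<open>(f Q) y = 0\<close> says that the total inflow into \<open>y\<close> is zero; so \<open>f\<close> also
  vanishes at every state that can jump to \<open>y\<close>, and by irreducibility everywhere.
\<close>

lemma invariant_measure_zero:
  assumes fin: "finite S" and irr: "ctmc_irreducible S q"
    and q: "\<And>x y. x \<in> S \<Longrightarrow> y \<in> S \<Longrightarrow> 0 \<le> q x y"
    and f: "\<And>x. x \<in> S \<Longrightarrow> 0 \<le> f x"
    and inv: "\<And>y. y \<in> S \<Longrightarrow> (\<Sum>x\<in>S. f x * ctmc_generator S q x y) = 0"
    and x0: "x0 \<in> S" "f x0 = 0" and x: "x \<in> S"
  shows "f x = 0"
proof -
  have inflow: "f u = 0" if step: "ctmc_step S q u v" and v: "f v = 0" for u v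
  proof -
    have uv: "u \<in> S" "v \<in> S" "u \<noteq> v" "q u v > 0" using step by (auto simp: ctmc_step_def)
    have "f z * ctmc_generator S q z v \<ge> 0" if "z \<in> S" for z
      using that uv q f v by (cases "z = v") (auto simp: ctmc_generator_def)
    with inv[OF uv(2)] fin have "f u * ctmc_generator S q u v = 0"
      using uv(1) by (simp add: sum_nonneg_eq_0_iff)
    then show ?thesis using uv by (simp add: ctmc_generator_def)
  qed
  have "(ctmc_step S q)\<^sup>*\<^sup>* x x0" using irr x x0 by (auto simp: ctmc_irreducible_def)
  then show ?thesis
    by (induction rule: converse_rtranclp_induct) (use x0 inflow in auto)
qed

text \<open>
  Subtract from \<open>\<mu>\<close> the largest multiple \<open>c \<nu>\<close> that keeps the difference nonnegative. The difference is
  invariant and has a zero, so it vanishes; since both laws have mass \<open>1\<close>, \<open>c = 1\<close>.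
\<close>

lemma stationary_distribution_unique:
  assumes fin: "finite S" and irr: "ctmc_irreducible S q"
    and q: "\<And>x y. x \<in> S \<Longrightarrow> y \<in> S \<Longrightarrow> 0 \<le> q x y"
    and mu: "stationary_distribution S q \<mu>" and nu: "stationary_distribution S q \<nu>"
  shows "\<mu> = \<nu>"
proof -
  have sub: "set_pmf \<mu> \<subseteq> S" "set_pmf \<nu> \<subseteq> S"
    and inv: "\<And>y. y \<in> S \<Longrightarrow> (\<Sum>x\<in>S. pmf \<mu> x * ctmc_generator S q x y) = 0"
      "\<And>y. y \<in> S \<Longrightarrow> (\<Sum>x\<in>S. pmf \<nu> x * ctmc_generator S q x y) = 0"
    using mu nu by (auto simp: stationary_distribution_iff_generator[OF fin])
  have mass: "(\<Sum>x\<in>S. pmf \<mu> x) = 1" "(\<Sum>x\<in>S. pmf \<nu> x) = 1"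
    using sub by (auto intro: sum_pmf_eq_1 fin)
  then have ne: "S \<noteq> {}" by auto
  have pos: "pmf \<nu> x > 0" if "x \<in> S" for x
  proof (rule ccontr)
    assume "\<not> pmf \<nu> x > 0"
    then have x0: "pmf \<nu> x = 0" using pmf_nonneg[of \<nu> x] by linarith
    have "pmf \<nu> y = 0" if "y \<in> S" for y
      using invariant_measure_zero[OF fin irr q _ inv(2) \<open>x \<in> S\<close> x0 that] by simp
    with mass(2) show False by simp
  qed
  define c where "c = Min ((\<lambda>x. pmf \<mu> x / pmf \<nu> x) ` S)"
  have "c \<in> (\<lambda>x. pmf \<mu> x / pmf \<nu> x) ` S" unfolding c_def using fin ne by (intro Min_in) auto
  then obtain x0 where x0: "x0 \<in> S" "c = pmf \<mu> x0 / pmf \<nu> x0" by auto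
  have cle: "c \<le> pmf \<mu> x / pmf \<nu> x" if "x \<in> S" for x
    unfolding c_def using fin that by (intro Min_le) auto
  have "pmf \<mu> x - c * pmf \<nu> x = 0" if x: "x \<in> S" for x
  proof (rule invariant_measure_zero[OF fin irr q, where f = "\<lambda>x. pmf \<mu> x - c * pmf \<nu> x"])
    show "0 \<le> pmf \<mu> x - c * pmf \<nu> x" if "x \<in> S" for x
      using cle[OF that] pos[OF that] by (simp add: field_simps)
    show "(\<Sum>x\<in>S. (pmf \<mu> x - c * pmf \<nu> x) * ctmc_generator S q x y) = 0" if "y \<in> S" for y
      using inv[OF that]
      by (simp add: left_diff_distrib sum_subtractf mult.assoc flip: sum_distrib_left)
    show "pmf \<mu> x0 - c * pmf \<nu> x0 = 0" using x0 pos[OF x0(1)] by simp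
  qed (use x x0 in auto)
  then have eq: "pmf \<mu> x = c * pmf \<nu> x" if "x \<in> S" for x using that by fastforce
  then have "c = 1" using mass by (simp flip: sum_distrib_left)
  show ?thesis
  proof (rule pmf_eqI)
    fix x
    show "pmf \<mu> x = pmf \<nu> x"
    proof (cases "x \<in> S")
      case True
      then show ?thesis using eq \<open>c = 1\<close> by simp
    next
      case False
      then show ?thesis using sub by (metis pmf_eq_0_set_pmf subsetD)
    qed
  qed
qed


section \<open>Transitions of the open TASEP\<close>

lemma configs_01: "\<tau> \<in> configs N \<Longrightarrow> j \<in> {1..N} \<Longrightarrow> \<tau> j = 0 \<or> \<tau> j = 1"
  by (auto simp: configs_def PiE_iff)

lemma configs_upd: "\<tau> \<in> configs N \<Longrightarrow> j \<in> {1..N} \<Longrightarrow> v \<in> {0, 1} \<Longrightarrow> \<tau>(j := v) \<in> configs N"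
  by (auto simp: configs_def PiE_iff extensional_def)

lemma finite_configs: "finite (configs N)"
  by (simp add: configs_def finite_PiE)

lemma tasep_rate_nonneg: "0 \<le> \<alpha> \<Longrightarrow> 0 \<le> \<beta> \<Longrightarrow> 0 \<le> tasep_rate N \<alpha> \<beta> \<sigma> \<tau>"
  by (auto simp: tasep_rate_def intro!: add_nonneg_nonneg sum_nonneg)

lemma tasep_rate_self: "tasep_rate N \<alpha> \<beta> \<sigma> \<sigma> = 0"
proof -
  have "\<sigma> \<noteq> \<sigma>(j := 0, j + 1 := 1)" if "\<sigma> j = 1" for j
    using that by (metis fun_upd_other fun_upd_same n_not_Suc_n Suc_eq_plus1 zero_neq_one)
  moreover have "\<sigma> \<noteq> \<sigma>(1 := 1)" if "\<sigma> 1 = 0" using that by (metis fun_upd_same zero_neq_one)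
  moreover have "\<sigma> \<noteq> \<sigma>(N := 0)" if "\<sigma> N = 1" using that by (metis fun_upd_same zero_neq_one)
  ultimately show ?thesis unfolding tasep_rate_def by (subst sum.neutral) auto
qed

lemma tasep_step_hop:
  assumes "0 < \<alpha>" "0 < \<beta>" "\<sigma> \<in> configs N" "j \<in> {1..<N}" "\<sigma> j = 1" "\<sigma> (j + 1) = 0"
  shows "ctmc_step (configs N) (tasep_rate N \<alpha> \<beta>) \<sigma> (\<sigma>(j := 0, j + 1 := 1))"
proof -
  let ?\<tau> = "\<sigma>(j := 0, j + 1 := 1)"
  have "(1::real) \<le> (\<Sum>i\<in>{1..<N}. if \<sigma> i = 1 \<and> \<sigma> (i + 1) = 0 \<and> ?\<tau> = \<sigma>(i := 0, i + 1 := 1) then 1 else 0)"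
    using assms by (intro order.trans[OF _ member_le_sum[of j]]) auto
  then have "0 < tasep_rate N \<alpha> \<beta> \<sigma> ?\<tau>"
    unfolding tasep_rate_def using assms(1,2) by (intro add_pos_nonneg) auto
  moreover from this have "\<sigma> \<noteq> ?\<tau>" using tasep_rate_self by (metis less_irrefl)
  moreover have "?\<tau> \<in> configs N" using assms by (intro configs_upd) auto
  ultimately show ?thesis using assms(3) by (simp add: ctmc_step_def)
qed

lemma tasep_step_insert:
  assumes "0 < \<alpha>" "0 < \<beta>" "\<sigma> \<in> configs N" "1 \<le> N" "\<sigma> 1 = 0"
  shows "ctmc_step (configs N) (tasep_rate N \<alpha> \<beta>) \<sigma> (\<sigma>(1 := 1))"
proof -
  have "0 < tasep_rate N \<alpha> \<beta> \<sigma> (\<sigma>(1 := 1))"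
    unfolding tasep_rate_def using assms
    by (intro add_pos_nonneg add_nonneg_pos sum_nonneg) auto
  moreover from this have "\<sigma> \<noteq> \<sigma>(1 := 1)" using tasep_rate_self by (metis less_irrefl)
  moreover have "\<sigma>(1 := 1) \<in> configs N" using assms by (intro configs_upd) auto
  ultimately show ?thesis using assms(3) by (simp add: ctmc_step_def)
qed

lemma tasep_step_remove:
  assumes "0 < \<alpha>" "0 < \<beta>" "\<sigma> \<in> configs N" "1 \<le> N" "\<sigma> N = 1"
  shows "ctmc_step (configs N) (tasep_rate N \<alpha> \<beta>) \<sigma> (\<sigma>(N := 0))"
proof -
  have "0 < tasep_rate N \<alpha> \<beta> \<sigma> (\<sigma>(N := 0))"
    unfolding tasep_rate_def using assms
    by (intro add_nonneg_pos add_nonneg_nonneg sum_nonneg) auto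
  moreover from this have "\<sigma> \<noteq> \<sigma>(N := 0)" using tasep_rate_self by (metis less_irrefl)
  moreover have "\<sigma>(N := 0) \<in> configs N" using assms by (intro configs_upd) auto
  ultimately show ?thesis using assms(3) by (simp add: ctmc_step_def)
qed

lemma sum_mult_fun_upd:
  fixes c \<tau> :: "'i \<Rightarrow> 'a::comm_ring_1"
  assumes "finite A" "j \<in> A"
  shows "(\<Sum>i\<in>A. c i * (\<tau>(j := v)) i) = (\<Sum>i\<in>A. c i * \<tau> i) + c j * (v - \<tau> j)"
  using assms by (simp add: sum.remove[of A j] algebra_simps)

text \<open>
  The chain can be emptied by letting the rightmost particle move until it exits: each of these steps
  lowers the sum over the particles of their distances to the right reservoir.
\<close>

lemma tasep_reaches_empty:
  assumes ab: "0 < \<alpha>" "0 < \<beta>" and N: "1 \<le> N" and "\<sigma> \<in> configs N"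
  shows "(ctmc_step (configs N) (tasep_rate N \<alpha> \<beta>))\<^sup>*\<^sup>* \<sigma> (\<lambda>j\<in>{1..N}. 0)"
proof -
  define M :: "(nat \<Rightarrow> int) \<Rightarrow> int" where "M \<tau> = (\<Sum>j\<in>{1..N}. (int N + 1 - int j) * \<tau> j)" for \<tau>
  have M0: "0 \<le> M \<tau>" if "\<tau> \<in> configs N" for \<tau>
    unfolding M_def using configs_01[OF that] by (intro sum_nonneg mult_nonneg_nonneg) fastforce+
  show ?thesis using assms(4)
  proof (induction \<sigma> rule: measure_induct_rule[where f = "\<lambda>\<tau>. nat (M \<tau>)"])
    case (less \<sigma>)
    let ?S = "{j \<in> {1..N}. \<sigma> j = 1}"
    show ?case
    proof (cases "?S = {}")
      case True
      then have "\<sigma> = (\<lambda>j\<in>{1..N}. 0)"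
        using less.prems configs_01[OF less.prems]
        by (fastforce simp: configs_def PiE_iff extensional_def restrict_def)
      then show ?thesis by simp
    next
      case False
      define j where "j = Max ?S"
      have "j \<in> ?S" unfolding j_def using False by (intro Max_in) auto
      then have j: "1 \<le> j" "j \<le> N" "\<sigma> j = 1" by auto
      have above: "\<sigma> i = 0" if "j < i" "i \<le> N" for i
      proof (rule ccontr)
        assume "\<sigma> i \<noteq> 0"
        then have "i \<in> ?S" using that j configs_01[OF less.prems, of i] by auto
        then have "i \<le> j" unfolding j_def by (intro Max_ge) auto
        then show False using that by simp
      qed
      have "\<exists>\<sigma>'. ctmc_step (configs N) (tasep_rate N \<alpha> \<beta>) \<sigma> \<sigma>' \<and> M \<sigma>' < M \<sigma>"
      proof (cases "j = N")
        case True
        then have "M (\<sigma>(N := 0)) < M \<sigma>" unfolding M_def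
          using j by (subst sum_mult_fun_upd) auto
        then show ?thesis using tasep_step_remove[OF ab less.prems N] True j by auto
      next
        case False
        with j have jN: "j < N" by simp
        have "M (\<sigma>(j := 0, j + 1 := 1)) < M \<sigma>" unfolding M_def
          using j jN above[of "j + 1"]
          by (subst sum_mult_fun_upd, simp, simp, subst sum_mult_fun_upd) auto
        then show ?thesis using tasep_step_hop[OF ab less.prems, of j] j jN above[of "j + 1"] by auto
      qed
      then obtain \<sigma>' where st: "ctmc_step (configs N) (tasep_rate N \<alpha> \<beta>) \<sigma> \<sigma>'" and "M \<sigma>' < M \<sigma>"
        by blast
      moreover from st have "\<sigma>' \<in> configs N" by (simp add: ctmc_step_def)
      ultimately have "(ctmc_step (configs N) (tasep_rate N \<alpha> \<beta>))\<^sup>*\<^sup>* \<sigma>' (\<lambda>j\<in>{1..N}. 0)"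
        using M0[of \<sigma>'] by (intro less.IH) (auto simp: nat_less_eq_zless)
      with st show ?thesis by (rule converse_rtranclp_into_rtranclp)
    qed
  qed
qed

text \<open>
  Read backwards in time, the leftmost particle moves left until it leaves through site \<open>1\<close>, which lowers the
  sum of the positions.
\<close>

lemma tasep_reachable_from_empty:
  assumes ab: "0 < \<alpha>" "0 < \<beta>" and N: "1 \<le> N" and "\<sigma> \<in> configs N"
  shows "(ctmc_step (configs N) (tasep_rate N \<alpha> \<beta>))\<^sup>*\<^sup>* (\<lambda>j\<in>{1..N}. 0) \<sigma>"
proof -
  define M :: "(nat \<Rightarrow> int) \<Rightarrow> int" where "M \<tau> = (\<Sum>j\<in>{1..N}. int j * \<tau> j)" for \<tau>
  have M0: "0 \<le> M \<tau>" if "\<tau> \<in> configs N" for \<tau>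
    unfolding M_def using configs_01[OF that] by (intro sum_nonneg mult_nonneg_nonneg) fastforce+
  show ?thesis using assms(4)
  proof (induction \<sigma> rule: measure_induct_rule[where f = "\<lambda>\<tau>. nat (M \<tau>)"])
    case (less \<sigma>)
    let ?S = "{j \<in> {1..N}. \<sigma> j = 1}"
    show ?case
    proof (cases "?S = {}")
      case True
      then have "\<sigma> = (\<lambda>j\<in>{1..N}. 0)"
        using less.prems configs_01[OF less.prems]
        by (fastforce simp: configs_def PiE_iff extensional_def restrict_def)
      then show ?thesis by simp
    next
      case False
      define j where "j = Min ?S"
      have "j \<in> ?S" unfolding j_def using False by (intro Min_in) auto
      then have j: "1 \<le> j" "j \<le> N" "\<sigma> j = 1" by auto
      have below: "\<sigma> i = 0" if "1 \<le> i" "i < j" for i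
      proof (rule ccontr)
        assume "\<sigma> i \<noteq> 0"
        then have "i \<in> ?S" using that j configs_01[OF less.prems, of i] by auto
        then have "j \<le> i" unfolding j_def by (intro Min_le) auto
        then show False using that by simp
      qed
      have "\<exists>\<sigma>'. ctmc_step (configs N) (tasep_rate N \<alpha> \<beta>) \<sigma>' \<sigma> \<and> M \<sigma>' < M \<sigma>"
      proof (cases "j = 1")
        case True
        then have "M (\<sigma>(1 := 0)) < M \<sigma>" unfolding M_def
          using j by (subst sum_mult_fun_upd) auto
        moreover have "(\<sigma>(1 := 0))(1 := 1) = \<sigma>" using True j by auto
        moreover have "\<sigma>(1 := 0) \<in> configs N" using less.prems N by (intro configs_upd) auto
        ultimately show ?thesis using tasep_step_insert[OF ab, of "\<sigma>(1 := 0)" N] N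
          by (intro exI[of _ "\<sigma>(1 := 0)"]) simp
      next
        case False
        with j obtain i where i: "j = i + 1" "1 \<le> i" by (cases j) auto
        let ?\<sigma>' = "\<sigma>(i := 1, i + 1 := 0)"
        have "M ?\<sigma>' < M \<sigma>" unfolding M_def
          using i j below[of i]
          by (subst sum_mult_fun_upd, simp, simp, subst sum_mult_fun_upd) auto
        moreover have "?\<sigma>'(i := 0, i + 1 := 1) = \<sigma>" using i j below[of i] by (auto simp: fun_eq_iff)
        moreover have "?\<sigma>' \<in> configs N" using less.prems i j by (intro configs_upd) auto
        ultimately show ?thesis using tasep_step_hop[OF ab, of ?\<sigma>' N i] i j
          by (intro exI[of _ ?\<sigma>']) simp
      qed
      then obtain \<sigma>' where st: "ctmc_step (configs N) (tasep_rate N \<alpha> \<beta>) \<sigma>' \<sigma>" and "M \<sigma>' < M \<sigma>"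
        by blast
      moreover from st have "\<sigma>' \<in> configs N" by (simp add: ctmc_step_def)
      ultimately have "(ctmc_step (configs N) (tasep_rate N \<alpha> \<beta>))\<^sup>*\<^sup>* (\<lambda>j\<in>{1..N}. 0) \<sigma>'"
        using M0[of \<sigma>'] by (intro less.IH) (auto simp: nat_less_eq_zless)
      then show ?thesis using st by (meson rtranclp.rtrancl_into_rtrancl)
    qed
  qed
qed

lemma tasep_irreducible:
  assumes "0 < \<alpha>" "0 < \<beta>" "1 \<le> N"
  shows "ctmc_irreducible (configs N) (tasep_rate N \<alpha> \<beta>)"
  unfolding ctmc_irreducible_def
  using tasep_reaches_empty[OF assms] tasep_reachable_from_empty[OF assms] by (meson rtranclp_trans)

lemma sum_mult_single:
  fixes f :: "'b \<Rightarrow> real"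
  assumes "finite S" "y \<in> S"
  shows "(\<Sum>x\<in>S. f x * (if P \<and> x = y then r else 0)) = r * (if P then f y else 0)"
  using assms by (cases P) (simp_all add: if_distrib cong: if_cong)

text \<open>
  Inflow minus outflow at \<open>\<tau>\<close>, grouped by the place of the transition: each summand belongs to one
  bond or to one reservoir.
\<close>

lemma tasep_generator_sum:
  assumes N: "1 \<le> N" and t: "\<tau> \<in> configs N"
  shows "(\<Sum>\<sigma>\<in>configs N. f \<sigma> * ctmc_generator (configs N) (tasep_rate N \<alpha> \<beta>) \<sigma> \<tau>)
    = (\<Sum>j\<in>{1..<N}. (if \<tau> j = 0 \<and> \<tau> (j + 1) = 1 then f (\<tau>(j := 1, j + 1 := 0)) else 0)
                    - (if \<tau> j = 1 \<and> \<tau> (j + 1) = 0 then f \<tau> else 0))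
      + \<alpha> * ((if \<tau> 1 = 1 then f (\<tau>(1 := 0)) else 0) - (if \<tau> 1 = 0 then f \<tau> else 0))
      + \<beta> * ((if \<tau> N = 0 then f (\<tau>(N := 1)) else 0) - (if \<tau> N = 1 then f \<tau> else 0))"
proof -
  let ?S = "configs N" and ?q = "tasep_rate N \<alpha> \<beta>"
  note fin = finite_configs[of N]
  have "(\<Sum>\<sigma>\<in>?S. f \<sigma> * ctmc_generator ?S ?q \<sigma> \<tau>)
      = (\<Sum>\<sigma>\<in>?S. f \<sigma> * ?q \<sigma> \<tau> - (if \<sigma> = \<tau> then f \<tau> * (\<Sum>\<rho>\<in>?S. ?q \<tau> \<rho>) else 0))"
    using fin t
    by (intro sum.cong) (auto simp: ctmc_generator_def tasep_rate_self sum.remove[of _ \<tau>])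
  also have "\<dots> = (\<Sum>\<sigma>\<in>?S. f \<sigma> * ?q \<sigma> \<tau>) - f \<tau> * (\<Sum>\<rho>\<in>?S. ?q \<tau> \<rho>)"
    using fin t by (simp add: sum_subtractf)
  \<comment> \<open>Inflow: a transition can be undone, so at each place \<open>\<tau>\<close> has at most one predecessor.\<close>
  also have "(\<Sum>\<sigma>\<in>?S. f \<sigma> * ?q \<sigma> \<tau>)
      = (\<Sum>j\<in>{1..<N}. if \<tau> j = 0 \<and> \<tau> (j + 1) = 1 then f (\<tau>(j := 1, j + 1 := 0)) else 0)
        + \<alpha> * (if \<tau> 1 = 1 then f (\<tau>(1 := 0)) else 0)
        + \<beta> * (if \<tau> N = 0 then f (\<tau>(N := 1)) else 0)"
  proof -
    have hop: "(\<Sum>\<sigma>\<in>?S. f \<sigma> * (if \<sigma> j = 1 \<and> \<sigma> (j + 1) = 0 \<and> \<tau> = \<sigma>(j := 0, j + 1 := 1) then 1 else 0))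
        = (if \<tau> j = 0 \<and> \<tau> (j + 1) = 1 then f (\<tau>(j := 1, j + 1 := 0)) else 0)"
      if j: "j \<in> {1..<N}" for j
    proof -
      have eq: "(\<sigma> j = 1 \<and> \<sigma> (j + 1) = 0 \<and> \<tau> = \<sigma>(j := 0, j + 1 := 1))
          \<longleftrightarrow> (\<tau> j = 0 \<and> \<tau> (j + 1) = 1) \<and> \<sigma> = \<tau>(j := 1, j + 1 := 0)" for \<sigma>
        by (auto intro!: ext)
      have mem: "\<tau>(j := 1, j + 1 := 0) \<in> ?S" using t j by (intro configs_upd) auto
      show ?thesis unfolding eq sum_mult_single[OF fin mem] by (rule mult_1)
    qed
    have ins: "(\<Sum>\<sigma>\<in>?S. f \<sigma> * (if \<sigma> 1 = 0 \<and> \<tau> = \<sigma>(1 := 1) then \<alpha> else 0))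
        = \<alpha> * (if \<tau> 1 = 1 then f (\<tau>(1 := 0)) else 0)"
    proof -
      have eq: "(\<sigma> 1 = 0 \<and> \<tau> = \<sigma>(1 := 1)) \<longleftrightarrow> \<tau> 1 = 1 \<and> \<sigma> = \<tau>(1 := 0)" for \<sigma>
        by (auto intro!: ext)
      have mem: "\<tau>(1 := 0) \<in> ?S" using t N by (intro configs_upd) auto
      show ?thesis unfolding eq by (rule sum_mult_single[OF fin mem])
    qed
    have rem: "(\<Sum>\<sigma>\<in>?S. f \<sigma> * (if \<sigma> N = 1 \<and> \<tau> = \<sigma>(N := 0) then \<beta> else 0))
        = \<beta> * (if \<tau> N = 0 then f (\<tau>(N := 1)) else 0)"
    proof -
      have eq: "(\<sigma> N = 1 \<and> \<tau> = \<sigma>(N := 0)) \<longleftrightarrow> \<tau> N = 0 \<and> \<sigma> = \<tau>(N := 1)" for \<sigma>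
        by (auto intro!: ext)
      have mem: "\<tau>(N := 1) \<in> ?S" using t N by (intro configs_upd) auto
      show ?thesis unfolding eq by (rule sum_mult_single[OF fin mem])
    qed
    show ?thesis
      unfolding tasep_rate_def distrib_left sum.distrib ins rem sum_distrib_left
      by (subst sum.swap) (use hop in simp)
  qed
  \<comment> \<open>Outflow: each possible transition has one target in the state space, so only its rate remains.\<close>
  also have "f \<tau> * (\<Sum>\<rho>\<in>?S. ?q \<tau> \<rho>)
      = (\<Sum>j\<in>{1..<N}. if \<tau> j = 1 \<and> \<tau> (j + 1) = 0 then f \<tau> else 0)
        + \<alpha> * (if \<tau> 1 = 0 then f \<tau> else 0) + \<beta> * (if \<tau> N = 1 then f \<tau> else 0)"
  proof -
    have hop: "(\<Sum>\<rho>\<in>?S. f \<tau> * (if \<tau> j = 1 \<and> \<tau> (j + 1) = 0 \<and> \<rho> = \<tau>(j := 0, j + 1 := 1) then 1 else 0))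
        = (if \<tau> j = 1 \<and> \<tau> (j + 1) = 0 then f \<tau> else 0)" if j: "j \<in> {1..<N}" for j
    proof -
      have mem: "\<tau>(j := 0, j + 1 := 1) \<in> ?S" using t j by (intro configs_upd) auto
      show ?thesis
        using sum_mult_single[OF fin mem, of "\<lambda>_. f \<tau>" "\<tau> j = 1 \<and> \<tau> (j + 1) = 0" 1]
        by (simp only: conj_assoc mult_1)
    qed
    have "\<tau>(1 := 1) \<in> ?S" "\<tau>(N := 0) \<in> ?S" using t N by (auto intro!: configs_upd)
    note bd = this[THEN sum_mult_single[OF fin, where f = "\<lambda>_. f \<tau>"]]
    show ?thesis
      unfolding tasep_rate_def distrib_left sum.distrib bd sum_distrib_left
      by (subst sum.swap) (use hop in simp)
  qed
  finally show ?thesis by (simp add: sum_subtractf right_diff_distrib)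
qed


section \<open>The matrix product\<close>

text \<open>
  The matrices \<open>D\<close> (for \<open>x = 1\<close>) and \<open>E\<close> (for \<open>x = 0\<close>), acting on column vectors indexed by heights: the entries
  of row \<open>h\<close> are the weights of the steps that the reflected difference walk can take from height \<open>h\<close>.
\<close>

definition site_op :: "real \<Rightarrow> int \<Rightarrow> (nat \<Rightarrow> real) \<Rightarrow> nat \<Rightarrow> real" where
  "site_op a x f h =
     (if x = 1 then f h + f (Suc h) else if h = 0 then (1 + a) * f 0 else f h + f (h - 1))"

definition mp_weight :: "real \<Rightarrow> real \<Rightarrow> int list \<Rightarrow> real" where
  "mp_weight a b xs = foldr (site_op a) xs (\<lambda>h. b ^ h) 0"

text \<open>
  This is \<open>D E = D + E\<close>. From height \<open>h\<close>, if \<open>D\<close> stays then \<open>E\<close> acts at \<open>h\<close>; if \<open>D\<close> goes up to \<open>h + 1 > 0\<close>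
  then \<open>E\<close> is not reflected and leads to \<open>h + 1\<close> or \<open>h\<close>, as \<open>D\<close> does.
\<close>

lemma site_op_exchange:
  "site_op a 1 (site_op a 0 f) = (\<lambda>h. site_op a 1 f h + site_op a 0 f h)"
  by (auto simp: site_op_def fun_eq_iff)

lemma foldr_site_op_add:
  "foldr (site_op a) xs (\<lambda>h. f h + g h) = (\<lambda>h. foldr (site_op a) xs f h + foldr (site_op a) xs g h)"
  by (induction xs) (auto simp: site_op_def fun_eq_iff algebra_simps)

lemma foldr_site_op_scale:
  "foldr (site_op a) xs (\<lambda>h. c * f h) = (\<lambda>h. c * foldr (site_op a) xs f h)"
  by (induction xs) (auto simp: site_op_def fun_eq_iff algebra_simps)

lemma mp_weight_bulk:
  "mp_weight a b (us @ 1 # 0 # vs) = mp_weight a b (us @ 1 # vs) + mp_weight a b (us @ 0 # vs)"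
  by (simp add: mp_weight_def site_op_exchange foldr_site_op_add)

lemma mp_weight_left: "mp_weight a b (0 # vs) = (1 + a) * mp_weight a b vs"
  by (simp add: mp_weight_def site_op_def)

lemma mp_weight_right: "mp_weight a b (us @ [1]) = (1 + b) * mp_weight a b us"
proof -
  have "site_op a 1 (\<lambda>h. b ^ h) = (\<lambda>h. (1 + b) * b ^ h)"
    by (auto simp: site_op_def fun_eq_iff algebra_simps)
  then show ?thesis by (simp add: mp_weight_def foldr_site_op_scale)
qed

lemma upt_split_bond:
  assumes "1 \<le> j" "j < N"
  shows "[1..<Suc N] = [1..<j] @ j # Suc j # [Suc (Suc j)..<Suc N]"
proof -
  have "[1..<Suc N] = [1..<j] @ [j..<Suc N]"
    using assms by (metis le_Suc_eq less_imp_le upt_add_eq_append le_add_diff_inverse)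
  then show ?thesis using assms by (simp add: upt_conv_Cons del: upt_Suc)
qed

text \<open>
  The net inflow through the bond from \<open>j\<close> to \<open>j + 1\<close> is \<open>g j - g (j + 1)\<close>, where \<open>g j\<close> is, up to sign, the weight
  of the configuration with site \<open>j\<close> deleted. The exchange relation gives this on each bond and the boundary
  relations cancel the two surviving terms \<open>g 1\<close> and \<open>g N\<close>.
\<close>

lemma mp_weight_invariant:
  assumes N: "1 \<le> N" and t: "\<tau> \<in> configs N" and ab: "a > 0" "b > 0"
  shows "(\<Sum>\<sigma>\<in>configs N. mp_weight a b (map \<sigma> [1..<Suc N]) *
      ctmc_generator (configs N) (tasep_rate N (1 / (1 + a)) (1 / (1 + b))) \<sigma> \<tau>) = 0"
proof -
  define w where "w \<sigma> = mp_weight a b (map \<sigma> [1..<Suc N])" for \<sigma>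
  define g where
    "g j = (1 - 2 * real_of_int (\<tau> j)) * mp_weight a b (map \<tau> ([1..<j] @ [Suc j..<Suc N]))" for j
  have bond: "(if \<tau> j = 0 \<and> \<tau> (j + 1) = 1 then w (\<tau>(j := 1, j + 1 := 0)) else 0)
      - (if \<tau> j = 1 \<and> \<tau> (j + 1) = 0 then w \<tau> else 0) = g j - g (Suc j)" if j: "j \<in> {1..<N}" for j
  proof -
    define us vs where "us = map \<tau> [1..<j]" and "vs = map \<tau> [Suc (Suc j)..<Suc N]"
    have spl: "[1..<Suc N] = [1..<j] @ j # Suc j # [Suc (Suc j)..<Suc N]"
      using j by (intro upt_split_bond) auto
    have w: "w \<tau> = mp_weight a b (us @ \<tau> j # \<tau> (Suc j) # vs)"
      unfolding w_def spl us_def vs_def by simp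
    have w': "w (\<tau>(j := 1, j + 1 := 0)) = mp_weight a b (us @ 1 # 0 # vs)"
    proof -
      have "map (\<tau>(j := 1, j + 1 := 0)) [1..<j] = us"
        "map (\<tau>(j := 1, j + 1 := 0)) [Suc (Suc j)..<Suc N] = vs"
        unfolding us_def vs_def by (rule map_cong; auto)+
      then show ?thesis unfolding w_def spl by simp
    qed
    have u: "[Suc j..<Suc N] = Suc j # [Suc (Suc j)..<Suc N]" "[1..<Suc j] = [1..<j] @ [j]"
      using j by (simp_all add: upt_conv_Cons)
    have g: "g j = (1 - 2 * real_of_int (\<tau> j)) * mp_weight a b (us @ \<tau> (Suc j) # vs)"
      "g (Suc j) = (1 - 2 * real_of_int (\<tau> (Suc j))) * mp_weight a b (us @ \<tau> j # vs)"
      unfolding g_def us_def vs_def u by (simp_all del: upt_Suc)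
    have "\<tau> j = 0 \<or> \<tau> j = 1" "\<tau> (Suc j) = 0 \<or> \<tau> (Suc j) = 1"
      using configs_01[OF t] j by auto
    then show ?thesis unfolding w w' g by (auto simp: mp_weight_bulk)
  qed
  have left: "1 / (1 + a) * ((if \<tau> 1 = 1 then w (\<tau>(1 := 0)) else 0) - (if \<tau> 1 = 0 then w \<tau> else 0))
      = - g 1"
  proof -
    have spl: "[1..<Suc N] = 1 # [Suc 1..<Suc N]" using N by (simp add: upt_conv_Cons del: upt_Suc)
    have "map (\<tau>(1 := 0)) [Suc 1..<Suc N] = map \<tau> [Suc 1..<Suc N]" by (rule map_cong) auto
    then have "w (\<tau>(1 := 0)) = (1 + a) * mp_weight a b (map \<tau> [Suc 1..<Suc N])"
      unfolding w_def spl by (simp add: mp_weight_left del: upt_Suc)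
    moreover have "w \<tau> = (1 + a) * mp_weight a b (map \<tau> [Suc 1..<Suc N])" if "\<tau> 1 = 0"
      using that unfolding w_def spl by (simp add: mp_weight_left del: upt_Suc)
    moreover have "\<tau> 1 = 0 \<or> \<tau> 1 = 1" using configs_01[OF t] N by auto
    ultimately show ?thesis using ab by (auto simp: g_def simp del: upt_Suc)
  qed
  have right: "1 / (1 + b) * ((if \<tau> N = 0 then w (\<tau>(N := 1)) else 0) - (if \<tau> N = 1 then w \<tau> else 0))
      = g N"
  proof -
    have spl: "[1..<Suc N] = [1..<N] @ [N]" using N by simp
    have "map (\<tau>(N := 1)) [1..<N] = map \<tau> [1..<N]" by (rule map_cong) auto
    then have "w (\<tau>(N := 1)) = (1 + b) * mp_weight a b (map \<tau> [1..<N])"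
      unfolding w_def spl by (simp add: mp_weight_right)
    moreover have "w \<tau> = (1 + b) * mp_weight a b (map \<tau> [1..<N])" if "\<tau> N = 1"
      using that unfolding w_def spl by (simp add: mp_weight_right)
    moreover have "\<tau> N = 0 \<or> \<tau> N = 1" using configs_01[OF t] N by auto
    ultimately show ?thesis using ab by (auto simp: g_def)
  qed
  have "(\<Sum>j\<in>{1..<N}. g j - g (Suc j)) = g 1 - g N"
    using sum_Suc_diff'[OF N, of g] by (simp add: sum_subtractf)
  then show ?thesis
    unfolding w_def[symmetric] tasep_generator_sum[OF N t] left right
    using bond by simp
qed


section \<open>The second line of the ensemble\<close>

lemma paths_Suc:
  "paths (Suc n) = (\<lambda>(s, x). s(Suc n := s n + x)) ` (paths n \<times> {0, 1})"
proof (intro equalityI subsetI)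
  fix s assume s: "s \<in> paths (Suc n)"
  define s' where "s' = restrict s {0..n}"
  have "s' \<in> paths n"
    using s by (auto simp: s'_def paths_def)
  moreover have "\<forall>j\<in>{1..Suc n}. s j - s (j - 1) \<in> {0, 1}" using s by (simp add: paths_def)
  from bspec[OF this, of "Suc n"] have "s (Suc n) - s n \<in> {0, 1}" by simp
  moreover have "s = s'(Suc n := s' n + (s (Suc n) - s n))"
    using s by (auto simp: s'_def paths_def extensional_def fun_eq_iff)
  ultimately show "s \<in> (\<lambda>(s, x). s(Suc n := s n + x)) ` (paths n \<times> {0, 1})"
    by (intro image_eqI[of _ _ "(s', s (Suc n) - s n)"]) auto
next
  fix s assume "s \<in> (\<lambda>(s, x). s(Suc n := s n + x)) ` (paths n \<times> {0, 1})"
  then obtain t x where t: "t \<in> paths n" and x: "x \<in> {0, 1}" and s: "s = t(Suc n := t n + x)"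
    by auto
  have "s j - s (j - 1) \<in> {0, 1}" if j: "j \<in> {1..Suc n}" for j
  proof (cases "j = Suc n")
    case True
    then show ?thesis using s x by simp
  next
    case False
    with j have "j \<in> {1..n}" by auto
    then have "t j - t (j - 1) \<in> {0, 1}" using t unfolding paths_def by blast
    moreover have "j - 1 \<noteq> Suc n" using j by auto
    ultimately show ?thesis using s False by simp
  qed
  moreover have "s \<in> extensional {0..Suc n}" "s 0 = 0"
    using s t by (auto simp: paths_def extensional_def)
  ultimately show "s \<in> paths (Suc n)" unfolding paths_def by blast
qed

lemma inj_on_path_extend: "inj_on (\<lambda>(s, x). s(Suc n := s n + x)) (paths n \<times> {0, 1::int})"
proof (rule inj_onI, clarify)
  fix s s' :: "nat \<Rightarrow> int" and x x' :: int
  assume s: "s \<in> paths n" "s' \<in> paths n" and eq: "s(Suc n := s n + x) = s'(Suc n := s' n + x')"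
  have "s k = s' k" for k
  proof (cases "k = Suc n")
    case True
    then show ?thesis using s by (simp add: paths_def extensional_def)
  next
    case False
    then show ?thesis using fun_cong[OF eq, of k] by simp
  qed
  moreover from this have "x = x'" using fun_cong[OF eq, of "Suc n"] by simp
  ultimately show "s = s' \<and> x = x'" by auto
qed

lemma sum_paths_Suc:
  fixes F :: "(nat \<Rightarrow> int) \<Rightarrow> real"
  shows "(\<Sum>s\<in>paths (Suc n). F s)
    = (\<Sum>s\<in>paths n. F (s(Suc n := s n)) + F (s(Suc n := s n + 1)))"
proof -
  have "(\<Sum>s\<in>paths (Suc n). F s) = (\<Sum>(s, x)\<in>paths n \<times> {0, 1}. F (s(Suc n := s n + x)))"
    unfolding paths_Suc by (subst sum.reindex[OF inj_on_path_extend]) (simp add: case_prod_beta)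
  then show ?thesis by (simp add: sum.cartesian_product[symmetric])
qed

text \<open>
  Summing out \<open>s\<close> step by step. With \<open>d = s1 - s\<close> and \<open>m\<close> its running minimum, the height \<open>d - m\<close> above the running
  minimum moves like a reflected walk: an occupied site lets it stay or go up, an empty site lets it stay or go down,
  and a down step taken at height \<open>0\<close> lowers \<open>m\<close> instead, at the price of a factor \<open>a\<close>. This is the action of
  \<open>site_op\<close>. A general terminal function \<open>f\<close> lets the induction peel off the last site.
\<close>

lemma sum_paths_reflected:
  fixes \<tau> :: "nat \<Rightarrow> int"
  assumes "\<And>j. 1 \<le> j \<Longrightarrow> j \<le> n \<Longrightarrow> \<tau> j \<in> {0, 1}"
  defines "d \<equiv> \<lambda>s k. (\<Sum>j=1..k. \<tau> j) - s k"
  shows "(\<Sum>s\<in>paths n. a ^ nat (- Min (d s ` {0..n})) * f (nat (d s n - Min (d s ` {0..n}))))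
    = foldr (site_op a) (map \<tau> [1..<Suc n]) f 0"
  using assms(1)
proof (induction n arbitrary: f)
  case 0
  have "paths 0 = {\<lambda>k\<in>{0}. 0}"
    by (auto simp: paths_def extensional_def fun_eq_iff)
  then show ?case by (simp add: d_def)
next
  case (Suc n)
  define m where "m s = Min (d s ` {0..n})" for s
  define G where "G k s = a ^ nat (- Min (d s ` {0..k})) * f (nat (d s k - Min (d s ` {0..k})))"
    for k s
  have ext: "G (Suc n) (s(Suc n := v)) = a ^ nat (- min (m s) (d s n + \<tau> (Suc n) + s n - v)) *
      f (nat (d s n + \<tau> (Suc n) + s n - v - min (m s) (d s n + \<tau> (Suc n) + s n - v)))" for s v
  proof -
    have "d (s(Suc n := v)) ` {0..n} = d s ` {0..n}" by (rule image_cong) (auto simp: d_def)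
    moreover have "d (s(Suc n := v)) (Suc n) = d s n + \<tau> (Suc n) + s n - v" by (simp add: d_def)
    ultimately show ?thesis
      by (simp add: G_def m_def atLeast0_atMost_Suc min.commute)
  qed
  have step: "G (Suc n) (s(Suc n := s n)) + G (Suc n) (s(Suc n := s n + 1))
      = a ^ nat (- m s) * site_op a (\<tau> (Suc n)) f (nat (d s n - m s))" if s: "s \<in> paths n" for s
  proof -
    have "m s \<le> d s 0" "m s \<le> d s n" unfolding m_def by (intro Min_le; simp)+
    moreover have "d s 0 = 0" using s by (simp add: d_def paths_def)
    ultimately have m: "m s \<le> 0" "m s \<le> d s n" by auto
    obtain h where h: "d s n = m s + int h" using m(2) by (metis zle_iff_zadd)
    obtain p where p: "m s = - int p" using m(1) by (metis nonpos_int_cases)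
    consider "\<tau> (Suc n) = 1" | "\<tau> (Suc n) = 0" "h = 0" | h' where "\<tau> (Suc n) = 0" "h = Suc h'"
      using Suc.prems[of "Suc n"] by (cases h) auto
    then show ?thesis
    proof cases
      case 1
      have "nat (1 + int h) = Suc h" by simp
      then show ?thesis using 1 unfolding ext by (simp add: h p site_op_def algebra_simps min_def)
    next
      case 2
      have "nat (1 + int p) = Suc p" by simp
      then show ?thesis using 2 unfolding ext by (simp add: h p site_op_def algebra_simps min_def)
    next
      case 3
      have "nat (1 + int h') - Suc 0 = h'" by simp
      then show ?thesis using 3 unfolding ext by (simp add: h p site_op_def algebra_simps min_def)
    qed
  qed
  have "(\<Sum>s\<in>paths (Suc n). G (Suc n) s)
      = (\<Sum>s\<in>paths n. a ^ nat (- m s) * site_op a (\<tau> (Suc n)) f (nat (d s n - m s)))"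
    unfolding sum_paths_Suc using step by simp
  also have "\<dots> = foldr (site_op a) (map \<tau> [1..<Suc n]) (site_op a (\<tau> (Suc n)) f) 0"
    unfolding m_def using Suc.prems by (intro Suc.IH) auto
  also have "\<dots> = foldr (site_op a) (map \<tau> [1..<Suc (Suc n)]) f 0"
    by simp
  finally show ?case unfolding G_def .
qed

text \<open>
  With \<open>d\<close> the final value and \<open>m \<le> 0\<close> the minimum of the difference walk, the ensemble weight
  \<open>b\<^sup>d / (a b)\<^sup>m\<close> is \<open>a\<^sup>-\<^sup>m\<close> times the terminal function \<open>b\<^sup>h\<close> at the final reflected height \<open>h = d - m\<close>.
\<close>

lemma sum_tle_weight:
  assumes ab: "a > 0" "b > 0" and t: "\<tau> \<in> configs N"
  shows "(\<Sum>s\<in>paths N. tle_weight N a b (height N \<tau>, s)) = mp_weight a b (map \<tau> [1..<Suc N]) / 4 ^ N"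
proof -
  define d where "d s k = (\<Sum>j=1..k. \<tau> j) - s k" for s k
  have "tle_weight N a b (height N \<tau>, s)
      = a ^ nat (- Min (d s ` {0..N})) * b ^ nat (d s N - Min (d s ` {0..N})) / 4 ^ N"
    if s: "s \<in> paths N" for s
  proof -
    let ?m = "Min (d s ` {0..N})"
    have "(\<lambda>j. height N \<tau> j - s j) ` {0..N} = d s ` {0..N}"
      by (rule image_cong) (auto simp: height_def d_def)
    moreover have "height N \<tau> N - s N = d s N" by (simp add: height_def d_def)
    ultimately have tw: "tle_weight N a b (height N \<tau>, s) = b powi d s N / (a * b) powi ?m / 4 ^ N"
      using s height_in_paths[OF t] by (simp add: tle_weight_def pmf_P_rw)
    have "?m \<le> d s 0" "?m \<le> d s N" by (intro Min_le; simp)+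
    moreover have "d s 0 = 0" using s by (simp add: d_def paths_def)
    ultimately have m: "?m \<le> 0" "?m \<le> d s N" by auto
    obtain h where h: "d s N = ?m + int h" using m(2) by (metis zle_iff_zadd)
    obtain p where p: "?m = - int p" using m(1) by (metis nonpos_int_cases)
    have dN: "d s N = int h - int p" using h p by simp
    have "b powi d s N / (a * b) powi ?m = b powi (int h - int p) * (a * b) ^ p"
      unfolding dN p by (simp add: power_int_minus field_simps)
    also have "\<dots> = a ^ p * b ^ h"
      using ab by (simp add: power_int_diff power_mult_distrib)
    finally show ?thesis unfolding tw using h p by simp
  qed
  then have "(\<Sum>s\<in>paths N. tle_weight N a b (height N \<tau>, s))
      = (\<Sum>s\<in>paths N. a ^ nat (- Min (d s ` {0..N})) * b ^ nat (d s N - Min (d s ` {0..N}))) / 4 ^ N"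
    by (simp add: sum_divide_distrib)
  also have "\<dots> = foldr (site_op a) (map \<tau> [1..<Suc N]) (\<lambda>h. b ^ h) 0 / 4 ^ N"
    unfolding d_def using configs_01[OF t] by (subst sum_paths_reflected) auto
  finally show ?thesis by (simp add: mp_weight_def)
qed

section \<open>The first marginal and the stationary law\<close>

lemma pmf_map_fst_P_TLE:
  assumes "a > 0" "b > 0"
  shows "pmf (map_pmf fst (P_TLE N a b)) s = (\<Sum>s'\<in>paths N. pmf (P_TLE N a b) (s, s'))"
proof -
  have zero: "pmf (P_TLE N a b) p = 0" if "p \<notin> paths N \<times> paths N" for p
    using that by (cases p) (auto simp: pmf_P_TLE[OF assms] tle_weight_def pmf_P_rw)
  have "pmf (map_pmf fst (P_TLE N a b)) s = measure (P_TLE N a b) (fst -` {s})"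
    by (simp add: pmf_map)
  also have "\<dots> = measure (P_TLE N a b) (Pair s ` paths N)"
    by (rule measure_prob_cong_0) (auto intro!: zero)
  also have "\<dots> = (\<Sum>p\<in>Pair s ` paths N. pmf (P_TLE N a b) p)"
    using finite_paths by (intro measure_measure_pmf_finite) auto
  also have "\<dots> = (\<Sum>s'\<in>paths N. pmf (P_TLE N a b) (s, s'))"
    by (subst sum.reindex) (auto simp: inj_on_def)
  finally show ?thesis .
qed

theorem theorem1p1:
  fixes N :: nat and a b :: real
  assumes "N \<ge> 1" and "a > 0" and "b > 0"
  shows "(\<exists>!\<mu>. tasep_stationary N (1 / (1 + a)) (1 / (1 + b)) \<mu>)
       \<and> map_pmf fst (P_TLE N a b) = P_H N (1 / (1 + a)) (1 / (1 + b))
       \<and> (\<forall>s\<in>paths N. pmf (P_H N (1 / (1 + a)) (1 / (1 + b))) s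
                       = (\<Sum>s'\<in>paths N. pmf (P_TLE N a b) (s, s')))"
proof -
  let ?\<alpha> = "1 / (1 + a)" and ?\<beta> = "1 / (1 + b)"
  note ab = assms(2,3)
  \<comment> \<open>\<open>\<mu>\<close> is the law of the increments of the first line; it will turn out to be the stationary law.\<close>
  define \<nu> where "\<nu> = map_pmf fst (P_TLE N a b)"
  define \<mu> where "\<mu> = map_pmf (the_inv_into (configs N) (height N)) \<nu>"
  have inj: "inj_on (height N) (configs N)" and img: "height N ` configs N = paths N"
    using bij_betw_height[of N] by (auto simp: bij_betw_def)
  have supp: "set_pmf \<nu> \<subseteq> paths N"
  proof
    fix s assume "s \<in> set_pmf \<nu>"
    then obtain s' where "pmf (P_TLE N a b) (s, s') \<noteq> 0" by (auto simp: \<nu>_def set_pmf_iff)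
    then show "s \<in> paths N" by (auto simp: pmf_P_TLE[OF ab] tle_weight_def pmf_P_rw split: if_splits)
  qed
  have sub: "set_pmf \<mu> \<subseteq> configs N"
    using supp inj img by (auto simp: \<mu>_def intro!: the_inv_into_into[OF inj])
  have lift: "map_pmf (height N) \<mu> = \<nu>"
  proof -
    have "map_pmf (height N) \<mu> = map_pmf (\<lambda>s. s) \<nu>"
      unfolding \<mu>_def pmf.map_comp
      using supp img by (intro map_pmf_cong) (auto simp: f_the_inv_into_f[OF inj])
    then show ?thesis by simp
  qed
  have pmf_mu: "pmf \<mu> \<tau> = mp_weight a b (map \<tau> [1..<Suc N]) * (1 / 4 ^ N / tle_const N a b)"
    if t: "\<tau> \<in> configs N" for \<tau>
  proof -
    have "pmf \<mu> \<tau> = pmf \<nu> (height N \<tau>)"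
    proof -
      have "pmf \<nu> (height N \<tau>) = measure \<mu> (height N -` {height N \<tau>})"
        by (simp add: lift[symmetric] pmf_map)
      also have "\<dots> = measure \<mu> {\<tau>}"
        using sub inj t
        by (intro measure_prob_cong_0) (auto simp: pmf_eq_0_set_pmf dest: inj_onD)
      finally show ?thesis by (simp add: measure_pmf_single)
    qed
    also have "\<dots> = (\<Sum>s\<in>paths N. tle_weight N a b (height N \<tau>, s)) / tle_const N a b"
      unfolding \<nu>_def pmf_map_fst_P_TLE[OF ab] by (simp add: pmf_P_TLE[OF ab] sum_divide_distrib)
    finally show ?thesis by (simp add: sum_tle_weight[OF ab t])
  qed
  have stat: "tasep_stationary N ?\<alpha> ?\<beta> \<mu>"
    unfolding tasep_stationary_def stationary_distribution_iff_generator[OF finite_configs]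
  proof (intro conjI ballI sub)
    fix \<tau> assume t: "\<tau> \<in> configs N"
    have "(\<Sum>\<sigma>\<in>configs N. pmf \<mu> \<sigma> * ctmc_generator (configs N) (tasep_rate N ?\<alpha> ?\<beta>) \<sigma> \<tau>)
        = (1 / 4 ^ N / tle_const N a b) * (\<Sum>\<sigma>\<in>configs N. mp_weight a b (map \<sigma> [1..<Suc N]) *
            ctmc_generator (configs N) (tasep_rate N ?\<alpha> ?\<beta>) \<sigma> \<tau>)"
      unfolding sum_distrib_left by (intro sum.cong refl) (simp add: pmf_mu)
    then show "(\<Sum>\<sigma>\<in>configs N. pmf \<mu> \<sigma> * ctmc_generator (configs N) (tasep_rate N ?\<alpha> ?\<beta>) \<sigma> \<tau>) = 0"
      using mp_weight_invariant[OF assms(1) t ab] by simp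
  qed
  have uniq: "\<mu>' = \<mu>" if "tasep_stationary N ?\<alpha> ?\<beta> \<mu>'" for \<mu>'
    using that stat unfolding tasep_stationary_def
    by (rule stationary_distribution_unique[OF finite_configs tasep_irreducible tasep_rate_nonneg,
        rotated -2]) (use ab assms(1) in auto)
  have "P_TASEP N ?\<alpha> ?\<beta> = \<mu>"
    unfolding P_TASEP_def using stat uniq by (rule the_equality)
  then have PH: "P_H N ?\<alpha> ?\<beta> = \<nu>" by (simp add: P_H_def lift)
  have "\<exists>!\<mu>. tasep_stationary N ?\<alpha> ?\<beta> \<mu>" using stat uniq by blast
  then show ?thesis using PH pmf_map_fst_P_TLE[OF ab] by (simp add: \<nu>_def)
qed

end
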